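(* Let $H$ be one of the following selfadjoint operators: (i) $H=(-\Delta)^{\alpha}$ on $L^2(\mathbb{R}^n)$, with $n\ge1$ and $\alpha>\frac12$; (ii) $H=h^{\alpha}$ on $L^2(\mathbb{R}^n)$ with $n=1$, where $\alpha>\frac12$, $h=-\partial_x^2+V$, and $V\ge0$ satisfies Assumption (A) or Assumption (B) (spelled out in the context); (iii) $H=(-\Delta)^m+V$ on $L^2(\mathbb{R}^n)$, where $m\ge2$ is an integer, $n\ge7$ if $m=2$ and $n>2m$ if $m\ge3$, and the real-valued $V$ satisfies Assumption (H) (spelled out in the context). Let $E\subset\mathbb{R}^n$ be a measurable set such that for every real $\tau\neq0$ there is a constant $C_\tau$ for which $$\|e^{-itH}w\|_{L^2(\mathbb{R}^n)}\le C_\tau\left(\|w\|_{L^2(E^c)}+\|e^{-i\tau H}w\|_{L^2(E^c)}\right)\qquad\text{for all } t\in\mathbb{R},\ w\in L^2(\mathbb{R}^n).$$ Then for every $T>0$ there is a constant $C$, depending only on $E$, $T$, $n$ and $H$ (i.e. on $\alpha$ or $m$, and on $V$ if present), such that $$\|u_0\|_{L^2(\mathbb{R}^n)}^2\le C\int_0^T\|e^{-itH}u_0\|_{L^2(E^c)}^2\,dt\qquad\text{for all } u_0\in L^2(\mathbb{R}^n).$$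
   Context: $\langle x\rangle=(1+|x|^2)^{1/2}$ and $E^c=\mathbb{R}^n\setminus E$. For $\alpha>0$, $(-\Delta)^\alpha$ is the nonnegative selfadjoint operator on $L^2(\mathbb{R}^n)$ with Fourier multiplier $|\xi|^{2\alpha}$. Case (ii). For $N\ge0$, $L^1_N(\mathbb{R})$ is the space of measurable $f:\mathbb{R}\to\mathbb{R}$ with $\|\langle x\rangle^Nf\|_{L^1(\mathbb{R})}<\infty$. For real $V\in L^1_1(\mathbb{R})$, $h=-\partial_x^2+V$ is the selfadjoint operator on $L^2(\mathbb{R})$ with form domain $H^1(\mathbb{R})$; if $V\ge0$ it is nonnegative and $h^\alpha$ is defined by the spectral theorem. For real $\lambda$, the Jost functions $f_\pm(\lambda,x)$ are the unique solutions of $(-\partial_x^2+V)f=\lambda^2f$ with $|f_\pm(\lambda,x)-e^{\pm i\lambda x}|\to0$ as $x\to\pm\infty$, and $W(\lambda)=f_+\,\partial_xf_--f_-\,\partial_xf_+$ is their Wronskian (independent of $x$). Assumption (A): there is $N\in\mathbb{N}$, $N>\frac{4\alpha-1}{2\alpha-1}$, with $V\in L^1_N(\mathbb{R})$, and $W(0)\neq0$. Assumption (B): there is $N\in\mathbb{N}$, $N>\frac{6\alpha-2}{2\alpha-1}$, with $V\in L^1_N(\mathbb{R})$, and $W(0)=0$. Case (iii). $H=(-\Delta)^m+V$ has domain $H^{2m}(\mathbb{R}^n)$; $\mathcal{F}$ is the Fourier transform and $H^\delta$ the $L^2$-based Sobolev space of order $\delta$. Assumption (H) on $V$ consists of the following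 three requirements. (1) There exists $\delta>0$ such that: if $2m<n<4m-1$, $\|\langle\cdot\rangle^{\frac{4m+1-n}{2}+\delta}V\|_{L^2}<\infty$; if $n=4m-1$, $\|\langle\cdot\rangle^{1+\delta}V\|_{H^\delta}<\infty$; if $n>4m-1$, $\|\mathcal{F}(\langle\cdot\rangle^{\sigma}V)\|_{L^{\frac{n-1-\delta}{n-2m-\delta}}}<\infty$ for some $\sigma>\frac{2n-4m}{n-1-\delta}+\delta$. (2) $|V(x)|\lesssim\langle x\rangle^{-\beta}$ for some $\beta$ with $\beta>n+5$ when $n$ is odd, $\beta>n+4$ when $n$ is even. (3) $H$ has no positive eigenvalues, and zero energy is regular, meaning that the only distributional solution $\psi$ of $H\psi=0$ with $\langle x\rangle^{\frac n2-2m-\varepsilon}\psi\in L^2(\mathbb{R}^n)$ for every $\varepsilon>0$ is $\psi=0$. *)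

theory Defs
  imports "HOL-Analysis.Analysis"
begin

section \<open>Function spaces\<close>

text \<open>
  Elements of L^2 are represented by measurable functions; equality of elements is equality
  almost everywhere. The space R^n is any type of class \<open>euclidean_space\<close> with n = \<open>DIM('a)\<close>.
\<close>

definition L2 :: "('a::euclidean_space \<Rightarrow> complex) set" where
  "L2 = {f. f \<in> borel_measurable lebesgue \<and> integrable lebesgue (\<lambda>x. (cmod (f x))\<^sup>2)}"

definition L2_norm_on :: "'a::euclidean_space set \<Rightarrow> ('a \<Rightarrow> complex) \<Rightarrow> real" where
  "L2_norm_on S f = sqrt (LINT x:S|lebesgue. (cmod (f x))\<^sup>2)"

definition L2_inner :: "('a::euclidean_space \<Rightarrow> complex) \<Rightarrow> ('a \<Rightarrow> complex) \<Rightarrow> complex" where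
  "L2_inner f g = (LINT x|lebesgue. f x * cnj (g x))"

text \<open>Only exponents \<open>1 \<le> p < \<infinity>\<close> are admitted.\<close>

definition Lp :: "real \<Rightarrow> ('a::euclidean_space \<Rightarrow> complex) set" where
  "Lp p = {f. 1 \<le> p \<and> f \<in> borel_measurable lebesgue \<and>
              integrable lebesgue (\<lambda>x. cmod (f x) powr p)}"

definition japanese_bracket :: "'a::euclidean_space \<Rightarrow> real" where
  "japanese_bracket x = sqrt (1 + (norm x)\<^sup>2)"

definition weighted_L1 :: "real \<Rightarrow> (real \<Rightarrow> real) set" where
  "weighted_L1 N = {f. f \<in> borel_measurable lebesgue \<and>
                       integrable lebesgue (\<lambda>x. japanese_bracket x powr N * f x)}"

definition partial :: "'a::euclidean_space \<Rightarrow> ('a \<Rightarrow> complex) \<Rightarrow> 'a \<Rightarrow> complex" where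
  "partial b f = (\<lambda>x. frechet_derivative f (at x) b)"

primrec C_k :: "nat \<Rightarrow> ('a::euclidean_space \<Rightarrow> complex) \<Rightarrow> bool" where
  "C_k 0 f \<longleftrightarrow> continuous_on UNIV f"
| "C_k (Suc k) f \<longleftrightarrow> (\<forall>x. f differentiable (at x)) \<and> (\<forall>b\<in>Basis. C_k k (partial b f))"

definition smooth :: "('a::euclidean_space \<Rightarrow> complex) \<Rightarrow> bool" where
  "smooth f \<longleftrightarrow> (\<forall>k. C_k k f)"

definition test_function :: "('a::euclidean_space \<Rightarrow> complex) \<Rightarrow> bool" where
  "test_function \<phi> \<longleftrightarrow> smooth \<phi> \<and> (\<exists>R. \<forall>x. norm x > R \<longrightarrow> \<phi> x = 0)"

definition schwartz :: "('a::euclidean_space \<Rightarrow> complex) \<Rightarrow> bool" where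
  "schwartz \<phi> \<longleftrightarrow> smooth \<phi> \<and>
     (\<forall>bs\<in>lists Basis. \<forall>k::nat. \<exists>C. \<forall>x. norm x ^ k * cmod (foldr partial bs \<phi> x) \<le> C)"

definition fourier_integral :: "('a::euclidean_space \<Rightarrow> complex) \<Rightarrow> 'a \<Rightarrow> complex" where
  "fourier_integral \<phi> \<xi> =
     complex_of_real ((2 * pi) powr (- real DIM('a) / 2)) *
       (LINT x|lebesgue. cis (- (x \<bullet> \<xi>)) * \<phi> x)"

text \<open>
  \<open>is_fourier f g\<close>: the Fourier transform of \<open>f\<close>, in the sense of tempered distributions, is the
  function \<open>g\<close>. For \<open>f\<close> in L^2 this is the unitary (Plancherel) Fourier transform.
\<close>

definition is_fourier :: "('a::euclidean_space \<Rightarrow> complex) \<Rightarrow> ('a \<Rightarrow> complex) \<Rightarrow> bool" where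
  "is_fourier f g \<longleftrightarrow> f \<in> borel_measurable lebesgue \<and> g \<in> borel_measurable lebesgue \<and>
     (\<forall>\<phi>. schwartz \<phi> \<longrightarrow>
        integrable lebesgue (\<lambda>x. f x * fourier_integral \<phi> x) \<and>
        integrable lebesgue (\<lambda>\<xi>. g \<xi> * \<phi> \<xi>) \<and>
        (LINT x|lebesgue. f x * fourier_integral \<phi> x) = (LINT \<xi>|lebesgue. g \<xi> * \<phi> \<xi>))"

text \<open>The Sobolev space H^s for \<open>s \<ge> 0\<close>.\<close>

definition sobolev :: "real \<Rightarrow> ('a::euclidean_space \<Rightarrow> complex) set" where
  "sobolev s = {f \<in> L2. \<exists>g. is_fourier f g \<and>
                  (\<lambda>\<xi>. complex_of_real (japanese_bracket \<xi> powr s) * g \<xi>) \<in> L2}"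


section \<open>Unbounded operators and the spectral theorem\<close>

text \<open>
  An unbounded operator on L^2 is given by its graph, which is a set of pairs of L^2 functions
  closed under almost-everywhere equality in both components.
\<close>

type_synonym 'a operator = "(('a \<Rightarrow> complex) \<times> ('a \<Rightarrow> complex)) set"

text \<open>
  A projection-valued measure on the Borel sets of the real line. Being symmetric and everywhere
  defined on L^2, each \<open>P B\<close> is linear and compatible with almost-everywhere equality.
\<close>

definition projection_valued_measure ::
    "(real set \<Rightarrow> ('a::euclidean_space \<Rightarrow> complex) \<Rightarrow> ('a \<Rightarrow> complex)) \<Rightarrow> bool" where
  "projection_valued_measure P \<longleftrightarrow>
     (\<forall>B\<in>sets borel. \<forall>u\<in>L2. P B u \<in> L2) \<and>
     (\<forall>B\<in>sets borel. \<forall>u\<in>L2. \<forall>v\<in>L2. L2_inner (P B u) v = L2_inner u (P B v)) \<and>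
     (\<forall>B\<in>sets borel. \<forall>B'\<in>sets borel. \<forall>u\<in>L2.
        AE x in lebesgue. P B (P B' u) x = P (B \<inter> B') u x) \<and>
     (\<forall>u\<in>L2. AE x in lebesgue. P {} u x = 0) \<and>
     (\<forall>u\<in>L2. AE x in lebesgue. P UNIV u x = u x) \<and>
     (\<forall>A :: nat \<Rightarrow> real set. range A \<subseteq> sets borel \<longrightarrow> disjoint_family A \<longrightarrow>
        (\<forall>u\<in>L2. (\<lambda>N. L2_norm_on UNIV (\<lambda>x. (\<Sum>i<N. P (A i) u x) - P (\<Union>i. A i) u x))
                   \<longlonglongrightarrow> 0))"

definition spectral_measure ::
    "(real set \<Rightarrow> ('a::euclidean_space \<Rightarrow> complex) \<Rightarrow> ('a \<Rightarrow> complex)) \<Rightarrow>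
     ('a \<Rightarrow> complex) \<Rightarrow> real measure" where
  "spectral_measure P u =
     measure_of UNIV (sets borel) (\<lambda>B. ennreal ((L2_norm_on UNIV (P B u))\<^sup>2))"

definition spectral_domain ::
    "(real set \<Rightarrow> ('a::euclidean_space \<Rightarrow> complex) \<Rightarrow> ('a \<Rightarrow> complex)) \<Rightarrow>
     (real \<Rightarrow> complex) \<Rightarrow> ('a \<Rightarrow> complex) set" where
  "spectral_domain P f =
     {u \<in> L2. integrable (spectral_measure P u) (\<lambda>s. (cmod (f s))\<^sup>2)}"

text \<open>
  The operator given by integrating \<open>f\<close> against \<open>P\<close>. The integral of \<open>f\<close> against the complex
  measure \<open>B \<mapsto> \<langle>P B u, v\<rangle>\<close> is expressed by polarization; since the domain is dense,
  \<open>w\<close> is determined almost everywhere by \<open>u\<close>.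
\<close>

definition spectral_integral ::
    "(real set \<Rightarrow> ('a::euclidean_space \<Rightarrow> complex) \<Rightarrow> ('a \<Rightarrow> complex)) \<Rightarrow>
     (real \<Rightarrow> complex) \<Rightarrow> 'a operator" where
  "spectral_integral P f =
     {(u, w). u \<in> spectral_domain P f \<and> w \<in> L2 \<and>
        (\<forall>v\<in>spectral_domain P f. L2_inner w v =
           (\<Sum>k<4. \<i> ^ k * (LINT s|spectral_measure P (\<lambda>x. u x + \<i> ^ k * v x). f s)) / 4)}"

definition spectral_resolution ::
    "'a::euclidean_space operator \<Rightarrow>
     (real set \<Rightarrow> ('a \<Rightarrow> complex) \<Rightarrow> ('a \<Rightarrow> complex)) \<Rightarrow> bool" where
  "spectral_resolution H P \<longleftrightarrow>
     projection_valued_measure P \<and> H = spectral_integral P complex_of_real"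

text \<open>By the spectral theorem a selfadjoint operator has exactly one spectral resolution (up to
  almost-everywhere equality of the values), so \<open>P\<close> below is that of \<open>H\<close>.\<close>

definition functional_calculus ::
    "'a::euclidean_space operator \<Rightarrow> (real \<Rightarrow> complex) \<Rightarrow> 'a operator" where
  "functional_calculus H f =
     {(u, w). \<exists>P. spectral_resolution H P \<and> (u, w) \<in> spectral_integral P f}"

text \<open>The power is intended for nonnegative \<open>H\<close>; values of \<open>powr\<close> at negative arguments are then
  irrelevant.\<close>

definition operator_power :: "'a::euclidean_space operator \<Rightarrow> real \<Rightarrow> 'a operator" where
  "operator_power H \<alpha> = functional_calculus H (\<lambda>s. complex_of_real (s powr \<alpha>))"

text \<open>\<open>unitary_orbit H w u\<close>: \<open>u t = exp (- i t H) w\<close> for all real \<open>t\<close>.\<close>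

definition unitary_orbit ::
    "'a::euclidean_space operator \<Rightarrow> ('a \<Rightarrow> complex) \<Rightarrow> (real \<Rightarrow> 'a \<Rightarrow> complex) \<Rightarrow> bool" where
  "unitary_orbit H w u \<longleftrightarrow>
     (\<exists>P. spectral_resolution H P \<and>
          (\<forall>t. (w, u t) \<in> spectral_integral P (\<lambda>s. cis (- (t * s)))))"


section \<open>The operators\<close>

definition fractional_laplacian :: "real \<Rightarrow> 'a::euclidean_space operator" where
  "fractional_laplacian \<alpha> =
     {(u, w). u \<in> L2 \<and> w \<in> L2 \<and>
        (\<exists>g. is_fourier u g \<and>
             is_fourier w (\<lambda>\<xi>. complex_of_real (norm \<xi> powr (2 * \<alpha>)) * g \<xi>))}"

definition schrodinger_operator :: "nat \<Rightarrow> ('a::euclidean_space \<Rightarrow> real) \<Rightarrow> 'a operator" where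
  "schrodinger_operator m V =
     {(u, w). u \<in> sobolev (2 * real m) \<and> w \<in> L2 \<and>
        (\<exists>z. (u, z) \<in> fractional_laplacian (real m) \<and>
             (AE x in lebesgue. w x = z x + complex_of_real (V x) * u x))}"

text \<open>\<open>H1_with_derivative u u'\<close>: \<open>u\<close> is in H^1 of the real line, with weak derivative \<open>u'\<close>.\<close>

definition H1_with_derivative :: "(real \<Rightarrow> complex) \<Rightarrow> (real \<Rightarrow> complex) \<Rightarrow> bool" where
  "H1_with_derivative u u' \<longleftrightarrow> u \<in> L2 \<and> u' \<in> L2 \<and>
     (\<forall>\<phi>. test_function \<phi> \<longrightarrow>
        (LINT x|lebesgue. u x * partial 1 \<phi> x) = - (LINT x|lebesgue. u' x * \<phi> x))"

text \<open>The operator associated with the quadratic form of \<open>- d\<^sup>2/dx\<^sup>2 + V\<close> with form domain H^1.\<close>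

definition schrodinger_form_operator :: "(real \<Rightarrow> real) \<Rightarrow> real operator" where
  "schrodinger_form_operator V =
     {(u, w). w \<in> L2 \<and> (\<exists>u'. H1_with_derivative u u' \<and>
        (\<forall>v v'. H1_with_derivative v v' \<longrightarrow>
           L2_inner u' v' + (LINT x|lebesgue. complex_of_real (V x) * u x * cnj (v x))
             = L2_inner w v))}"

text \<open>Transport of an operator on the real line to a one-dimensional Euclidean space with basis
  vector \<open>b\<close> (the identity for the type of reals and \<open>b = 1\<close>).\<close>

definition on_line :: "'a::euclidean_space \<Rightarrow> real operator \<Rightarrow> 'a operator" where
  "on_line b A = {(\<lambda>x. u (x \<bullet> b), \<lambda>x. w (x \<bullet> b)) | u w. (u, w) \<in> A}"


section \<open>Jost functions and Assumptions (A), (B)\<close>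

text \<open>Since \<open>V\<close> is merely locally integrable, \<open>- f'' + V f = \<lambda>\<^sup>2 f\<close> is read in the Caratheodory
  sense: \<open>f\<close> is differentiable and \<open>f'\<close> is an indefinite integral of \<open>(V - \<lambda>\<^sup>2) f\<close>.\<close>

definition schrodinger_ode :: "(real \<Rightarrow> real) \<Rightarrow> real \<Rightarrow> (real \<Rightarrow> complex) \<Rightarrow> bool" where
  "schrodinger_ode V l f \<longleftrightarrow>
     (\<exists>g. (\<forall>x. (f has_vector_derivative g x) (at x)) \<and>
          (\<forall>x y. x \<le> y \<longrightarrow>
             g y - g x = (LINT s:{x..y}|lebesgue. complex_of_real (V s - l\<^sup>2) * f s)))"

definition jost_plus :: "(real \<Rightarrow> real) \<Rightarrow> real \<Rightarrow> real \<Rightarrow> complex" where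
  "jost_plus V l = (THE f. schrodinger_ode V l f \<and>
     ((\<lambda>x. cmod (f x - cis (l * x))) \<longlongrightarrow> 0) at_top)"

definition jost_minus :: "(real \<Rightarrow> real) \<Rightarrow> real \<Rightarrow> real \<Rightarrow> complex" where
  "jost_minus V l = (THE f. schrodinger_ode V l f \<and>
     ((\<lambda>x. cmod (f x - cis (- (l * x)))) \<longlongrightarrow> 0) at_bot)"

text \<open>The Wronskian does not depend on the point of evaluation; we evaluate at 0.\<close>

definition jost_wronskian :: "(real \<Rightarrow> real) \<Rightarrow> real \<Rightarrow> complex" where
  "jost_wronskian V l =
     jost_plus V l 0 * vector_derivative (jost_minus V l) (at 0)
     - jost_minus V l 0 * vector_derivative (jost_plus V l) (at 0)"

definition assumption_A :: "real \<Rightarrow> (real \<Rightarrow> real) \<Rightarrow> bool" where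
  "assumption_A \<alpha> V \<longleftrightarrow>
     (\<exists>N::nat. real N > (4 * \<alpha> - 1) / (2 * \<alpha> - 1) \<and> V \<in> weighted_L1 (real N)) \<and>
     jost_wronskian V 0 \<noteq> 0"

definition assumption_B :: "real \<Rightarrow> (real \<Rightarrow> real) \<Rightarrow> bool" where
  "assumption_B \<alpha> V \<longleftrightarrow>
     (\<exists>N::nat. real N > (6 * \<alpha> - 2) / (2 * \<alpha> - 1) \<and> V \<in> weighted_L1 (real N)) \<and>
     jost_wronskian V 0 = 0"


section \<open>Assumption (H)\<close>

definition neg_laplacian :: "('a::euclidean_space \<Rightarrow> complex) \<Rightarrow> 'a \<Rightarrow> complex" where
  "neg_laplacian f x = - (\<Sum>b\<in>Basis. partial b (partial b f) x)"

definition weighted :: "real \<Rightarrow> ('a::euclidean_space \<Rightarrow> complex) \<Rightarrow> 'a \<Rightarrow> complex" where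
  "weighted s f x = complex_of_real (japanese_bracket x powr s) * f x"

definition no_positive_eigenvalues :: "'a::euclidean_space operator \<Rightarrow> bool" where
  "no_positive_eigenvalues H \<longleftrightarrow>
     \<not> (\<exists>l::real. l > 0 \<and> (\<exists>\<psi>. (\<psi>, \<lambda>x. complex_of_real l * \<psi> x) \<in> H \<and>
                              \<not> (AE x in lebesgue. \<psi> x = 0)))"

definition distributional_null_solution ::
    "nat \<Rightarrow> ('a::euclidean_space \<Rightarrow> real) \<Rightarrow> ('a \<Rightarrow> complex) \<Rightarrow> bool" where
  "distributional_null_solution m V \<psi> \<longleftrightarrow>
     (\<forall>\<phi>. test_function \<phi> \<longrightarrow>
        (LINT x|lebesgue. \<psi> x * ((neg_laplacian ^^ m) \<phi> x + complex_of_real (V x) * \<phi> x)) = 0)"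

definition zero_energy_regular :: "nat \<Rightarrow> ('a::euclidean_space \<Rightarrow> real) \<Rightarrow> bool" where
  "zero_energy_regular m V \<longleftrightarrow>
     (\<forall>\<psi>::'a \<Rightarrow> complex.
        (\<forall>\<epsilon>>0. weighted (real DIM('a) / 2 - 2 * real m - \<epsilon>) \<psi> \<in> L2) \<longrightarrow>
        distributional_null_solution m V \<psi> \<longrightarrow> (AE x in lebesgue. \<psi> x = 0))"

text \<open>In the case \<open>n > 4 m - 1\<close>, membership in \<open>Lp\<close> forces \<open>\<delta> < n - 2 m\<close>, which is exactly what
  is needed for the Lebesgue exponent to be at least 1.\<close>

definition assumption_H1 :: "nat \<Rightarrow> ('a::euclidean_space \<Rightarrow> real) \<Rightarrow> bool" where
  "assumption_H1 m V \<longleftrightarrow>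
     (let n = real DIM('a); m' = real m; Vc = (\<lambda>x. complex_of_real (V x)) in
      \<exists>\<delta>>0.
        (2 * m' < n \<and> n < 4 * m' - 1 \<longrightarrow> weighted ((4 * m' + 1 - n) / 2 + \<delta>) Vc \<in> L2) \<and>
        (n = 4 * m' - 1 \<longrightarrow> weighted (1 + \<delta>) Vc \<in> sobolev \<delta>) \<and>
        (n > 4 * m' - 1 \<longrightarrow>
           (\<exists>\<sigma> > (2 * n - 4 * m') / (n - 1 - \<delta>) + \<delta>.
              \<exists>g. is_fourier (weighted \<sigma> Vc) g \<and> g \<in> Lp ((n - 1 - \<delta>) / (n - 2 * m' - \<delta>)))))"

definition assumption_H2 :: "('a::euclidean_space \<Rightarrow> real) \<Rightarrow> bool" where
  "assumption_H2 V \<longleftrightarrow>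
     (\<exists>\<beta>. (odd DIM('a) \<longrightarrow> \<beta> > real DIM('a) + 5) \<and>
          (even DIM('a) \<longrightarrow> \<beta> > real DIM('a) + 4) \<and>
          (\<exists>K. AE x in lebesgue. \<bar>V x\<bar> \<le> K * japanese_bracket x powr (- \<beta>)))"

definition assumption_H :: "nat \<Rightarrow> ('a::euclidean_space \<Rightarrow> real) \<Rightarrow> bool" where
  "assumption_H m V \<longleftrightarrow> V \<in> borel_measurable lebesgue \<and>
     assumption_H1 m V \<and> assumption_H2 V \<and>
     no_positive_eigenvalues (schrodinger_operator m V) \<and> zero_energy_regular m V"


section \<open>Admissible Hamiltonians\<close>

inductive admissible_hamiltonian :: "'a::euclidean_space operator \<Rightarrow> bool" where
  fractional: "\<alpha> > 1 / 2 \<Longrightarrow> admissible_hamiltonian (fractional_laplacian \<alpha>)"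
| one_dim: "\<lbrakk>DIM('a) = 1; b \<in> (Basis :: 'a set); \<alpha> > 1 / 2; AE x in lebesgue. 0 \<le> V x;
    assumption_A \<alpha> V \<or> assumption_B \<alpha> V\<rbrakk> \<Longrightarrow>
    admissible_hamiltonian (on_line b (operator_power (schrodinger_form_operator V) \<alpha>))"
| higher_order: "\<lbrakk>m \<ge> 2; m = 2 \<Longrightarrow> DIM('a) \<ge> 7; m \<ge> 3 \<Longrightarrow> DIM('a) > 2 * m;
    assumption_H m (V :: 'a \<Rightarrow> real)\<rbrakk> \<Longrightarrow>
    admissible_hamiltonian (schrodinger_operator m V)"

end

theory Submission
  imports Defs
begin

text \<open>
  The hypothesis with \<open>\<tau> = T / 2\<close>, applied to the orbit through \<open>u s\<close>, bounds the conserved norm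
  of \<open>u\<^sub>0\<close> by the observations at the times \<open>s\<close> and \<open>s + T / 2\<close>; squaring and integrating over
  \<open>0 \<le> s \<le> T / 2\<close> gives the claim. Of the Hamiltonian only the group law, the unitarity and the
  strong continuity of its evolution matter (strong continuity so that the time integral is not a
  junk value). These are read off from the spectral measure: a functional on bounded Borel
  functions that is linear and continuous under bounded convergence is determined by its values
  on indicators, where the multiplicativity of the functional calculus is \<open>P B (P B') = P (B \<inter> B')\<close>.
\<close>

section \<open>The inner product of L2\<close>

lemma L2_borel_measurable [measurable_dest]: "f \<in> L2 \<Longrightarrow> f \<in> borel_measurable lebesgue"
  by (simp add: L2_def)

lemma borel_measurable_cnj [measurable]:
  "f \<in> borel_measurable M \<Longrightarrow> (\<lambda>x. cnj (f x)) \<in> borel_measurable M"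
  by (rule borel_measurable_continuous_on[where f = cnj]) (intro continuous_intros)

lemma L2_cmult: "f \<in> L2 \<Longrightarrow> (\<lambda>x. c * f x) \<in> L2"
  by (auto simp: L2_def norm_mult power_mult_distrib)

lemma L2_add:
  assumes f: "f \<in> L2" and g: "g \<in> L2"
  shows "(\<lambda>x. f x + g x) \<in> L2"
proof -
  note [measurable] = L2_borel_measurable[OF f] L2_borel_measurable[OF g]
  have "integrable lebesgue (\<lambda>x. (cmod (f x + g x))\<^sup>2)"
  proof (rule Bochner_Integration.integrable_bound)
    show "integrable lebesgue (\<lambda>x. 2 * (cmod (f x))\<^sup>2 + 2 * (cmod (g x))\<^sup>2)"
      using f g by (auto simp: L2_def)
    have "(cmod (f x + g x))\<^sup>2 \<le> 2 * (cmod (f x))\<^sup>2 + 2 * (cmod (g x))\<^sup>2" for x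
    proof -
      have "(cmod (f x + g x))\<^sup>2 \<le> (cmod (f x) + cmod (g x))\<^sup>2"
        by (intro power_mono norm_triangle_ineq) auto
      also have "\<dots> \<le> 2 * (cmod (f x))\<^sup>2 + 2 * (cmod (g x))\<^sup>2"
        using sum_squares_bound[of "cmod (f x)" "cmod (g x)"] by (simp add: power2_sum)
      finally show ?thesis .
    qed
    then show "AE x in lebesgue. norm ((cmod (f x + g x))\<^sup>2)
        \<le> norm (2 * (cmod (f x))\<^sup>2 + 2 * (cmod (g x))\<^sup>2)"
      by auto
  qed measurable
  then show ?thesis
    by (auto simp: L2_def)
qed

lemma L2_diff:
  assumes "f \<in> L2" "g \<in> L2"
  shows "(\<lambda>x. f x - g x) \<in> L2"
  using L2_add[OF assms(1) L2_cmult[OF assms(2), of "-1"]] by simp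

lemma L2_sum:
  assumes "finite I" "\<And>i. i \<in> I \<Longrightarrow> f i \<in> L2"
  shows "(\<lambda>x. \<Sum>i\<in>I. f i x) \<in> L2"
  using assms
proof (induction I)
  case empty
  then show ?case by (simp add: L2_def)
next
  case (insert i I)
  then show ?case by (simp add: L2_add)
qed

lemma integrable_mult_cnj:
  assumes f: "f \<in> L2" and g: "g \<in> L2"
  shows "integrable lebesgue (\<lambda>x. f x * cnj (g x))"
proof (rule Bochner_Integration.integrable_bound)
  note [measurable] = L2_borel_measurable[OF f] L2_borel_measurable[OF g]
  show "integrable lebesgue (\<lambda>x. (cmod (f x))\<^sup>2 + (cmod (g x))\<^sup>2)"
    using f g by (auto simp: L2_def)
  show "(\<lambda>x. f x * cnj (g x)) \<in> borel_measurable lebesgue"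
    by measurable
  have "cmod (f x) * cmod (g x) \<le> (cmod (f x))\<^sup>2 + (cmod (g x))\<^sup>2" for x
  proof -
    have "2 * (cmod (f x) * cmod (g x)) \<le> (cmod (f x))\<^sup>2 + (cmod (g x))\<^sup>2"
      using sum_squares_bound[of "cmod (f x)" "cmod (g x)"] by simp
    then show ?thesis
      by (smt (verit) mult_nonneg_nonneg norm_ge_zero)
  qed
  then show "AE x in lebesgue. norm (f x * cnj (g x)) \<le> norm ((cmod (f x))\<^sup>2 + (cmod (g x))\<^sup>2)"
    by (auto simp: norm_mult)
qed

lemma L2_inner_commute: "L2_inner g f = cnj (L2_inner f g)"
  unfolding L2_inner_def
  using Bochner_Integration.integral_cnj[of lebesgue "\<lambda>x. f x * cnj (g x)"] by (simp add: mult.commute)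

lemma L2_inner_cmult_left: "L2_inner (\<lambda>x. c * f x) g = c * L2_inner f g"
  unfolding L2_inner_def by (simp add: mult.assoc)

lemma L2_inner_cmult_right: "L2_inner f (\<lambda>x. c * g x) = cnj c * L2_inner f g"
  by (subst (1 2) L2_inner_commute) (simp add: L2_inner_cmult_left)

lemma L2_inner_add_left:
  assumes "f \<in> L2" "g \<in> L2" "h \<in> L2"
  shows "L2_inner (\<lambda>x. f x + g x) h = L2_inner f h + L2_inner g h"
  unfolding L2_inner_def left_diff_distrib distrib_right
  using assms by (intro Bochner_Integration.integral_add integrable_mult_cnj)

lemma L2_inner_add_right:
  assumes "f \<in> L2" "g \<in> L2" "h \<in> L2"
  shows "L2_inner h (\<lambda>x. f x + g x) = L2_inner h f + L2_inner h g"
  by (subst (1 2 3) L2_inner_commute) (simp add: L2_inner_add_left assms)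

lemma L2_inner_diff_left:
  assumes "f \<in> L2" "g \<in> L2" "h \<in> L2"
  shows "L2_inner (\<lambda>x. f x - g x) h = L2_inner f h - L2_inner g h"
  unfolding L2_inner_def left_diff_distrib distrib_right
  using assms by (intro Bochner_Integration.integral_diff integrable_mult_cnj)

lemma L2_inner_diff_right:
  assumes "f \<in> L2" "g \<in> L2" "h \<in> L2"
  shows "L2_inner h (\<lambda>x. f x - g x) = L2_inner h f - L2_inner h g"
  by (subst (1 2 3) L2_inner_commute) (simp add: L2_inner_diff_left assms)

lemma L2_inner_sum_left:
  assumes "\<And>i. i \<in> I \<Longrightarrow> f i \<in> L2" "g \<in> L2"
  shows "L2_inner (\<lambda>x. \<Sum>i\<in>I. f i x) g = (\<Sum>i\<in>I. L2_inner (f i) g)"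
  unfolding L2_inner_def sum_distrib_right
  using assms by (intro Bochner_Integration.integral_sum integrable_mult_cnj)

lemma L2_inner_sum_right:
  assumes "\<And>i. i \<in> I \<Longrightarrow> f i \<in> L2" "g \<in> L2"
  shows "L2_inner g (\<lambda>x. \<Sum>i\<in>I. f i x) = (\<Sum>i\<in>I. L2_inner g (f i))"
  by (subst (1 2) L2_inner_commute) (simp add: L2_inner_sum_left assms)

lemma L2_inner_cong_AE:
  assumes "f \<in> L2" "f' \<in> L2" "g \<in> L2" "AE x in lebesgue. f x = f' x"
  shows "L2_inner f g = L2_inner f' g"
proof -
  note [measurable] = assms(1-3)[THEN L2_borel_measurable]
  show ?thesis
    unfolding L2_inner_def using assms(4) by (intro integral_cong_AE) auto
qed

section \<open>Norms over a set and their stability under small perturbations\<close>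

lemma L2_inner_self: "L2_inner f f = complex_of_real ((L2_norm_on UNIV f)\<^sup>2)"
proof -
  have "(LINT x|lebesgue. (cmod (f x))\<^sup>2) \<ge> 0"
    by (rule Bochner_Integration.integral_nonneg) simp
  moreover have "L2_inner f f = complex_of_real (LINT x|lebesgue. (cmod (f x))\<^sup>2)"
    unfolding L2_inner_def by (simp add: complex_norm_square[symmetric] flip: integral_complex_of_real)
  ultimately show ?thesis
    by (simp add: L2_norm_on_def set_lebesgue_integral_def)
qed

lemma L2_norm_on_nonneg [simp]: "0 \<le> L2_norm_on S f"
  by (auto simp: L2_norm_on_def set_lebesgue_integral_def intro!: Bochner_Integration.integral_nonneg)

lemma L2_norm_on_power2: "(L2_norm_on S f)\<^sup>2 = (LINT x:S|lebesgue. (cmod (f x))\<^sup>2)"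
  by (auto simp: L2_norm_on_def set_lebesgue_integral_def intro!: Bochner_Integration.integral_nonneg)

text \<open>Young's inequality with a free weight \<open>e\<close>, applied pointwise and
  integrated. A small \<open>e\<close> controls the second term; closeness of \<open>f\<close> to
  \<open>g\<close> then controls the first.\<close>

lemma L2_norm_on_power2_diff_le:
  assumes f: "f \<in> L2" and g: "g \<in> L2" and S: "S \<in> sets lebesgue" and e: "e > 0"
  shows "\<bar>(L2_norm_on S f)\<^sup>2 - (L2_norm_on S g)\<^sup>2\<bar>
    \<le> (1 + 1 / e) * (L2_norm_on UNIV (\<lambda>x. f x - g x))\<^sup>2 + e * (L2_norm_on UNIV g)\<^sup>2"
proof -
  let ?F = "\<lambda>x. (cmod (f x))\<^sup>2" and ?G = "\<lambda>x. (cmod (g x))\<^sup>2" and ?D = "\<lambda>x. (cmod (f x - g x))\<^sup>2"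
  have int: "integrable lebesgue ?F" "integrable lebesgue ?G" "integrable lebesgue ?D"
    using f g L2_diff[OF f g] by (auto simp: L2_def)
  have intS: "set_integrable lebesgue S ?F" "set_integrable lebesgue S ?G"
    using integrable_mult_indicator[OF S int(1)] integrable_mult_indicator[OF S int(2)]
    by (simp_all add: set_integrable_def)
  have pt: "\<bar>?F x - ?G x\<bar> \<le> (1 + 1 / e) * ?D x + e * ?G x" for x
  proof -
    define a b d where "a = cmod (f x)" and "b = cmod (g x)" and "d = cmod (f x - g x)"
    have pos: "0 \<le> a" "0 \<le> b" "0 \<le> d" by (auto simp: a_def b_def d_def)
    have ab: "\<bar>a - b\<bar> \<le> d"
      unfolding a_def b_def d_def by (rule norm_triangle_ineq3)
    have "\<bar>a\<^sup>2 - b\<^sup>2\<bar> = \<bar>a - b\<bar> * (a + b)"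
      using pos by (simp add: square_diff_square_factored power2_eq_square abs_mult mult.commute)
    also have "\<dots> \<le> d * (2 * b + d)"
      using ab pos by (intro mult_mono) auto
    also have "\<dots> \<le> (1 + 1 / e) * d\<^sup>2 + e * b\<^sup>2"
    proof -
      \<comment> \<open>Expanding gives
        \<open>2 * d * b \<le> d\<^sup>2 / e + e * b\<^sup>2\<close>; the extra
        \<open>d\<^sup>2\<close> accounts for the 1 in \<open>1 + 1 / e\<close>.\<close>
      have "0 \<le> (d / sqrt e - sqrt e * b)\<^sup>2" by simp
      also have "\<dots> = d\<^sup>2 / e + e * b\<^sup>2 - 2 * d * b"
        using e by (simp add: power2_diff power_divide power_mult_distrib)
      finally show ?thesis by (simp add: algebra_simps power2_eq_square)
    qed
    finally show ?thesis by (simp add: a_def b_def d_def)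
  qed
  have "(L2_norm_on S f)\<^sup>2 - (L2_norm_on S g)\<^sup>2 = (LINT x:S|lebesgue. ?F x - ?G x)"
    using intS by (simp add: L2_norm_on_power2 set_integral_diff)
  also have "\<bar>\<dots>\<bar> \<le> (LINT x|lebesgue. \<bar>indicator S x *\<^sub>R (?F x - ?G x)\<bar>)"
    unfolding set_lebesgue_integral_def by (rule integral_abs_bound)
  \<comment> \<open>The majorant is nonnegative, so it also dominates off \<open>S\<close>, and the
    bound does not depend on \<open>S\<close>.\<close>
  also have "\<dots> \<le> (LINT x|lebesgue. (1 + 1 / e) * ?D x + e * ?G x)"
  proof (rule integral_mono)
    show "integrable lebesgue (\<lambda>x. \<bar>indicator S x *\<^sub>R (?F x - ?G x)\<bar>)"
      using int S by (intro integrable_abs integrable_mult_indicator Bochner_Integration.integrable_diff)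
    show "integrable lebesgue (\<lambda>x. (1 + 1 / e) * ?D x + e * ?G x)"
      using int by (intro Bochner_Integration.integrable_add integrable_mult_right)
    have "0 \<le> (1 + 1 / e) * ?D x + e * ?G x" for x using e by simp
    then show "\<bar>indicator S x *\<^sub>R (?F x - ?G x)\<bar> \<le> (1 + 1 / e) * ?D x + e * ?G x" for x
      using pt[of x] by (auto simp: indicator_def)
  qed
  also have "\<dots> = (1 + 1 / e) * (L2_norm_on UNIV (\<lambda>x. f x - g x))\<^sup>2 + e * (L2_norm_on UNIV g)\<^sup>2"
    using int by (simp add: L2_norm_on_power2 set_lebesgue_integral_def)
  finally show ?thesis .
qed

section \<open>Functionals continuous under bounded convergence\<close>

text \<open>Boundedness is pointwise, not up to null sets, because one function gets integrated
  against the spectral measures of many vectors.\<close>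

definition bounded_borel :: "(real \<Rightarrow> complex) \<Rightarrow> bool" where
  "bounded_borel f \<longleftrightarrow> f \<in> borel_measurable borel \<and> (\<exists>K. \<forall>x. cmod (f x) \<le> K)"

lemma bounded_borelI: "f \<in> borel_measurable borel \<Longrightarrow> (\<And>x. cmod (f x) \<le> K) \<Longrightarrow> bounded_borel f"
  by (auto simp: bounded_borel_def)

lemma bounded_borel_add:
  assumes "bounded_borel f" "bounded_borel g"
  shows "bounded_borel (\<lambda>x. f x + g x)"
proof -
  obtain K L where "\<And>x. cmod (f x) \<le> K" "\<And>x. cmod (g x) \<le> L"
    using assms by (auto simp: bounded_borel_def)
  then have "cmod (f x + g x) \<le> K + L" for x
    by (meson add_mono norm_triangle_le)
  with assms show ?thesis
    by (auto simp: bounded_borel_def)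
qed

lemma bounded_borel_mult:
  assumes "bounded_borel f" "bounded_borel g"
  shows "bounded_borel (\<lambda>x. f x * g x)"
proof -
  obtain K L where KL: "\<And>x. cmod (f x) \<le> K" "\<And>x. cmod (g x) \<le> L"
    using assms by (auto simp: bounded_borel_def)
  have "cmod (f x * g x) \<le> K * L" for x
    unfolding norm_mult using KL by (intro mult_mono) (auto intro: order_trans[OF norm_ge_zero])
  with assms show ?thesis
    by (auto simp: bounded_borel_def)
qed

lemma bounded_borel_cmult: "bounded_borel f \<Longrightarrow> bounded_borel (\<lambda>x. c * f x)"
  by (rule bounded_borel_mult) (auto intro: bounded_borelI)

lemma bounded_borel_cnj: "bounded_borel f \<Longrightarrow> bounded_borel (\<lambda>x. cnj (f x))"
  by (auto simp: bounded_borel_def)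

lemma bounded_borel_indicator: "B \<in> sets borel \<Longrightarrow> bounded_borel (indicator B)"
  by (rule bounded_borelI[where K = 1]) (auto simp: indicator_def)

lemma bounded_borel_cis: "bounded_borel (\<lambda>s. cis (- (t * s)))"
  by (rule bounded_borelI[where K = 1]) (auto intro!: borel_measurable_continuous_onI continuous_intros)

text \<open>Models integration against a complex Borel measure by linearity and bounded convergence,
  so that combinations and conjugates of integrals against different measures are covered as
  well.\<close>

definition bounded_convergence_functional :: "((real \<Rightarrow> complex) \<Rightarrow> complex) \<Rightarrow> bool" where
  "bounded_convergence_functional L \<longleftrightarrow>
     (\<forall>f g. bounded_borel f \<longrightarrow> bounded_borel g \<longrightarrow> L (\<lambda>x. f x + g x) = L f + L g) \<and>
     (\<forall>c f. bounded_borel f \<longrightarrow> L (\<lambda>x. c * f x) = c * L f) \<and>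
     (\<forall>s f K. (\<forall>n. s n \<in> borel_measurable borel) \<longrightarrow> (\<forall>n x. cmod (s n x) \<le> K) \<longrightarrow>
        f \<in> borel_measurable borel \<longrightarrow>
        (\<forall>x. (\<lambda>n. s n x) \<longlonglongrightarrow> f x) \<longrightarrow> (\<lambda>n. L (s n)) \<longlonglongrightarrow> L f)"

lemma bounded_convergence_functionalD:
  assumes "bounded_convergence_functional L"
  shows "bounded_borel f \<Longrightarrow> bounded_borel g \<Longrightarrow> L (\<lambda>x. f x + g x) = L f + L g"
    and "bounded_borel f \<Longrightarrow> L (\<lambda>x. c * f x) = c * L f"
    and "(\<And>n. s n \<in> borel_measurable borel) \<Longrightarrow> (\<And>n x. cmod (s n x) \<le> K) \<Longrightarrow>
      f \<in> borel_measurable borel \<Longrightarrow> (\<And>x. (\<lambda>n. s n x) \<longlonglongrightarrow> f x) \<Longrightarrow> (\<lambda>n. L (s n)) \<longlonglongrightarrow> L f"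
  using assms unfolding bounded_convergence_functional_def by blast+

text \<open>A bounded Borel function is a pointwise limit of uniformly bounded simple functions, and
  these are finite combinations of indicators; linearity and bounded convergence carry the agreement
  over.\<close>

lemma bounded_convergence_functional_eqI:
  assumes L: "bounded_convergence_functional L" and M: "bounded_convergence_functional M"
    and eq: "\<And>B. B \<in> sets borel \<Longrightarrow> L (indicator B) = M (indicator B)"
    and f: "bounded_borel f"
  shows "L f = M f"
proof -
  have f_meas: "f \<in> borel_measurable borel" using f by (simp add: bounded_borel_def)
  obtain K where K: "\<And>x. cmod (f x) \<le> K" using f by (auto simp: bounded_borel_def)
  \<comment> \<open>Approximation around 0 comes with domination by \<open>2 * dist (f x) 0\<close>,
    which yields the common bound \<open>2 * K\<close> that bounded convergence asks for.\<close>
  obtain s :: "nat \<Rightarrow> real \<Rightarrow> complex" where s: "\<And>i. simple_function borel (s i)" "\<And>x. (\<lambda>i. s i x) \<longlonglongrightarrow> f x"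
    "\<And>i x. dist (s i x) 0 \<le> 2 * dist (f x) 0"
    using borel_measurable_implies_sequence_metric[OF f_meas, of 0] by auto
  have s_meas: "s i \<in> borel_measurable borel" for i
    using s(1) by (rule borel_measurable_simple_function)
  have s_bound: "cmod (s i x) \<le> 2 * K" for i x
    using s(3)[of i x] K[of x] by simp
  have simple: "L (s i) = M (s i)" for i
  proof -
    \<comment> \<open>\<open>g I\<close> keeps only the values of \<open>s i\<close> in
      \<open>I\<close>: induction on the finite set \<open>I\<close> reaches all values, and
      \<open>g (range (s i))\<close> is \<open>s i\<close> itself.\<close>
    define g where "g I = (\<lambda>x. \<Sum>y\<in>I. y * indicator (s i -` {y}) x)" for I :: "complex set"
    have vim: "s i -` {y} \<in> sets borel" for y
      using measurable_sets[OF s_meas, of "{y}"] by simp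
    have "bounded_borel (g I) \<and> L (g I) = M (g I)" if "finite I" for I
      using that
    proof induction
      case empty
      have 0: "bounded_borel (indicator {})" by (rule bounded_borel_indicator) simp
      \<comment> \<open>The zero function is written as a multiple of a bounded Borel function, so
        that homogeneity makes \<open>L\<close> and \<open>M\<close> vanish on it.\<close>
      have "g {} = (\<lambda>x. 0 * indicator {} x)" by (auto simp: g_def)
      then show ?case
        using bounded_convergence_functionalD(2)[OF L 0, of 0]
          bounded_convergence_functionalD(2)[OF M 0, of 0] bounded_borel_cmult[OF 0, of 0] by simp
    next
      case (insert y I)
      have ind: "bounded_borel (indicator (s i -` {y}))"
        by (rule bounded_borel_indicator[OF vim])
      have "g (insert y I) = (\<lambda>x. y * indicator (s i -` {y}) x + g I x)"
        using insert by (simp add: g_def del: sum_mult_indicator)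
      then show ?case
        using insert ind bounded_borel_cmult[OF ind, of y]
          bounded_convergence_functionalD(1,2)[OF L] bounded_convergence_functionalD(1,2)[OF M]
          eq[OF vim, of y] by (simp add: bounded_borel_add)
    qed
    moreover have "finite (range (s i))"
      using s(1)[of i] by (simp add: simple_function_def)
    moreover have "s i = g (range (s i))"
    proof
      fix x
      show "s i x = g (range (s i)) x"
        using \<open>finite (range (s i))\<close>
        by (simp add: g_def indicator_def if_distrib[of "(*) _"] sum.delta cong: if_cong)
    qed
    ultimately show ?thesis by metis
  qed
  have "(\<lambda>i. L (s i)) \<longlonglongrightarrow> L f" "(\<lambda>i. M (s i)) \<longlonglongrightarrow> M f"
    using bounded_convergence_functionalD(3)[OF L s_meas s_bound f_meas s(2)]
      bounded_convergence_functionalD(3)[OF M s_meas s_bound f_meas s(2)] by auto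
  then show ?thesis
    using simple by (auto intro: LIMSEQ_unique)
qed

text \<open>Keeps the factor \<open>g\<close> fixed while \<open>f\<close> varies, so that
  identities about products can be checked with \<open>f\<close> an indicator. Uniform bounds
  survive because \<open>g\<close> is bounded.\<close>

lemma bounded_convergence_functional_mult:
  assumes L: "bounded_convergence_functional L" and g: "bounded_borel g"
  shows "bounded_convergence_functional (\<lambda>f. L (\<lambda>x. g x * f x))"
  unfolding bounded_convergence_functional_def
proof (intro conjI allI impI)
  fix f h assume "bounded_borel f" "bounded_borel h"
  then show "L (\<lambda>x. g x * (f x + h x)) = L (\<lambda>x. g x * f x) + L (\<lambda>x. g x * h x)"
    using bounded_convergence_functionalD(1)[OF L] g by (simp add: distrib_left bounded_borel_mult)
next
  fix c f assume "bounded_borel f"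
  then show "L (\<lambda>x. g x * (c * f x)) = c * L (\<lambda>x. g x * f x)"
    using bounded_convergence_functionalD(2)[OF L, of "\<lambda>x. g x * f x" c] g
    by (simp add: mult.left_commute bounded_borel_mult)
next
  fix s :: "nat \<Rightarrow> real \<Rightarrow> complex" and f K
  assume s: "\<forall>n. s n \<in> borel_measurable borel" "\<forall>n x. cmod (s n x) \<le> K"
    "f \<in> borel_measurable borel" "\<forall>x. (\<lambda>n. s n x) \<longlonglongrightarrow> f x"
  obtain J where J: "\<And>x. cmod (g x) \<le> J" using g by (auto simp: bounded_borel_def)
  have "cmod (g x * s n x) \<le> J * K" for n x
    unfolding norm_mult using J s(2) by (intro mult_mono) (auto intro: order_trans[OF norm_ge_zero])
  note [measurable] = s(3) s(1)[rule_format]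
  have [measurable]: "g \<in> borel_measurable borel" using g by (simp add: bounded_borel_def)
  from s \<open>\<And>n x. cmod (g x * s n x) \<le> J * K\<close> show "(\<lambda>n. L (\<lambda>x. g x * s n x)) \<longlonglongrightarrow> L (\<lambda>x. g x * f x)"
    by (intro bounded_convergence_functionalD(3)[OF L, where K = "J * K"])
      (auto intro!: tendsto_intros)
qed

text \<open>Each conjugation alone would break complex homogeneity; together they restore it. This
  form arises when passing to adjoints.\<close>

lemma bounded_convergence_functional_cnj:
  assumes L: "bounded_convergence_functional L"
  shows "bounded_convergence_functional (\<lambda>f. cnj (L (\<lambda>x. cnj (f x))))"
  unfolding bounded_convergence_functional_def
proof (intro conjI allI impI)
  fix s :: "nat \<Rightarrow> real \<Rightarrow> complex" and f K
  assume s: "\<forall>n. s n \<in> borel_measurable borel" "\<forall>n x. cmod (s n x) \<le> K"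
    "f \<in> borel_measurable borel" "\<forall>x. (\<lambda>n. s n x) \<longlonglongrightarrow> f x"
  note [measurable] = s(3) s(1)[rule_format]
  from s show "(\<lambda>n. cnj (L (\<lambda>x. cnj (s n x)))) \<longlonglongrightarrow> cnj (L (\<lambda>x. cnj (f x)))"
    by (intro tendsto_intros bounded_convergence_functionalD(3)[OF L, where K = K])
      (auto intro!: tendsto_intros)
qed (use bounded_convergence_functionalD(1,2)[OF L] in \<open>simp_all add: bounded_borel_cnj\<close>)

lemma bounded_convergence_functional_sum:
  assumes "\<And>i. i \<in> I \<Longrightarrow> bounded_convergence_functional (L i)"
  shows "bounded_convergence_functional (\<lambda>f. \<Sum>i\<in>I. c i * L i f)"
  unfolding bounded_convergence_functional_def
proof (intro conjI allI impI)
  fix s :: "nat \<Rightarrow> real \<Rightarrow> complex" and f K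
  assume s: "\<forall>n. s n \<in> borel_measurable borel" "\<forall>n x. cmod (s n x) \<le> K"
    "f \<in> borel_measurable borel" "\<forall>x. (\<lambda>n. s n x) \<longlonglongrightarrow> f x"
  then show "(\<lambda>n. \<Sum>i\<in>I. c i * L i (s n)) \<longlonglongrightarrow> (\<Sum>i\<in>I. c i * L i f)"
    by (intro tendsto_intros bounded_convergence_functionalD(3)[OF assms, where K = K]) auto
qed (use bounded_convergence_functionalD(1,2)[OF assms] in
      \<open>simp_all add: distrib_left sum.distrib sum_distrib_left mult.left_commute\<close>)

text \<open>Finiteness of \<open>M\<close> makes the constant \<open>K\<close> an integrable
  majorant for dominated convergence.\<close>

lemma bounded_convergence_functional_integral:
  assumes M: "finite_measure M" and [measurable_cong]: "sets M = sets borel"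
  shows "bounded_convergence_functional (\<lambda>f. LINT x|M. f x)"
proof -
  interpret finite_measure M by fact
  have int: "integrable M f" if f: "bounded_borel f" for f :: "real \<Rightarrow> complex"
  proof -
    have [measurable]: "f \<in> borel_measurable borel" using f by (simp add: bounded_borel_def)
    obtain K where "\<And>x. cmod (f x) \<le> K" using f by (auto simp: bounded_borel_def)
    then show ?thesis
      by (intro integrable_const_bound[where B = K]) auto
  qed
  have lim: "(\<lambda>n. LINT x|M. s n x) \<longlonglongrightarrow> (LINT x|M. f x)"
    if s: "\<forall>n. s n \<in> borel_measurable borel" "\<forall>n x. cmod (s n x) \<le> K"
      "f \<in> borel_measurable borel" "\<forall>x. (\<lambda>n. s n x) \<longlonglongrightarrow> f x"
    for s :: "nat \<Rightarrow> real \<Rightarrow> complex" and f K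
  proof -
    note [measurable] = s(3) s(1)[rule_format]
    show ?thesis
      using s by (intro integral_dominated_convergence[where w = "\<lambda>_. K"]) auto
  qed
  show ?thesis
    unfolding bounded_convergence_functional_def using int lim by auto
qed

section \<open>Projection-valued measures\<close>

text \<open>The polarized right-hand side of \<open>spectral_integral\<close>, freed of its
  restriction on \<open>v\<close>: the integral of \<open>f\<close> against the complex measure
  \<open>B \<mapsto> L2_inner (P B u) v\<close>.\<close>

definition spectral_form ::
    "(real set \<Rightarrow> ('a::euclidean_space \<Rightarrow> complex) \<Rightarrow> ('a \<Rightarrow> complex)) \<Rightarrow>
     (real \<Rightarrow> complex) \<Rightarrow> ('a \<Rightarrow> complex) \<Rightarrow> ('a \<Rightarrow> complex) \<Rightarrow> complex" where
  "spectral_form P f u v =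
     (\<Sum>k<4. \<i> ^ k * (LINT s|spectral_measure P (\<lambda>x. u x + \<i> ^ k * v x). f s)) / 4"

locale pvm =
  fixes P :: "real set \<Rightarrow> ('a::euclidean_space \<Rightarrow> complex) \<Rightarrow> ('a \<Rightarrow> complex)"
  assumes pvm: "projection_valued_measure P"
begin

section \<open>Algebra and countable additivity of the projections\<close>

lemma P_L2: "B \<in> sets borel \<Longrightarrow> u \<in> L2 \<Longrightarrow> P B u \<in> L2"
  using pvm by (simp add: projection_valued_measure_def)

lemma P_symmetric:
  "B \<in> sets borel \<Longrightarrow> u \<in> L2 \<Longrightarrow> v \<in> L2 \<Longrightarrow> L2_inner (P B u) v = L2_inner u (P B v)"
  using pvm by (simp add: projection_valued_measure_def)

lemma P_UNIV: "u \<in> L2 \<Longrightarrow> AE x in lebesgue. P UNIV u x = u x"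
  using pvm by (simp add: projection_valued_measure_def)

lemma P_empty: "u \<in> L2 \<Longrightarrow> AE x in lebesgue. P {} u x = 0"
  using pvm by (simp add: projection_valued_measure_def)

lemma P_Int:
  "B \<in> sets borel \<Longrightarrow> B' \<in> sets borel \<Longrightarrow> u \<in> L2 \<Longrightarrow>
    AE x in lebesgue. P B (P B' u) x = P (B \<inter> B') u x"
  using pvm by (simp add: projection_valued_measure_def)

lemma P_countably_additive:
  "range A \<subseteq> sets borel \<Longrightarrow> disjoint_family A \<Longrightarrow> u \<in> L2 \<Longrightarrow>
    (\<lambda>N. L2_norm_on UNIV (\<lambda>x. (\<Sum>i<N. P (A i) u x) - P (\<Union>i. A i) u x)) \<longlonglongrightarrow> 0"
  for A :: "nat \<Rightarrow> real set"
  using pvm unfolding projection_valued_measure_def by blast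

text \<open>Symmetry moves \<open>P B'\<close> to the left, where it meets \<open>P B\<close> and
  composition becomes intersection.\<close>

lemma inner_P_P:
  assumes "B \<in> sets borel" "B' \<in> sets borel" "u \<in> L2" "v \<in> L2"
  shows "L2_inner (P B u) (P B' v) = L2_inner (P (B \<inter> B') u) v"
proof -
  have "L2_inner (P B u) (P B' v) = L2_inner (P B' (P B u)) v"
    using assms by (simp add: P_symmetric P_L2)
  also have "\<dots> = L2_inner (P (B' \<inter> B) u) v"
    using assms by (intro L2_inner_cong_AE P_Int P_L2) auto
  finally show ?thesis by (simp add: Int_commute)
qed

lemma norm_P_power2:
  assumes "B \<in> sets borel" "u \<in> L2"
  shows "complex_of_real ((L2_norm_on UNIV (P B u))\<^sup>2) = L2_inner (P B u) u"
  using inner_P_P[of B B u u] assms by (simp add: L2_inner_self)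

lemma norm_P_empty: "u \<in> L2 \<Longrightarrow> L2_norm_on UNIV (P {} u) = 0"
proof -
  assume u: "u \<in> L2"
  have "L2_inner (P {} u) u = L2_inner (\<lambda>x. 0) u"
    using u by (intro L2_inner_cong_AE P_empty P_L2) (auto simp: L2_def)
  then have "complex_of_real ((L2_norm_on UNIV (P {} u))\<^sup>2) = 0"
    using norm_P_power2[of "{}" u] u by (simp add: L2_inner_def)
  then show ?thesis by (simp del: of_real_power)
qed

text \<open>Since \<open>P (A i) u\<close> are orthogonal projections of \<open>P (\<Union>i. A i) u\<close>, the squared norm of
  the difference in \<open>P_countably_additive\<close> is a difference of squared norms.\<close>

lemma norm_P_sums:
  fixes A :: "nat \<Rightarrow> real set"
  assumes A: "range A \<subseteq> sets borel" "disjoint_family A" and u: "u \<in> L2"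
  shows "(\<lambda>i. (L2_norm_on UNIV (P (A i) u))\<^sup>2) sums (L2_norm_on UNIV (P (\<Union>i. A i) u))\<^sup>2"
proof -
  let ?m = "\<lambda>B. (L2_norm_on UNIV (P B u))\<^sup>2"
  let ?U = "\<Union>i. A i"
  have Ai: "A i \<in> sets borel" for i using A by auto
  have U: "?U \<in> sets borel" using A by (intro sets.countable_UN) auto
  note PL = P_L2[OF Ai u] P_L2[OF U u]
  \<comment> \<open>In the expanded square, the mixed terms each equal the sum of
    \<open>?m (A i)\<close> because \<open>A i\<close> lies in \<open>?U\<close>, and so does the
    square of the partial sum because disjoint sets give orthogonal vectors. One copy survives, with
    a minus sign.\<close>
  have eq: "(L2_norm_on UNIV (\<lambda>x. (\<Sum>i<N. P (A i) u x) - P ?U u x))\<^sup>2 = ?m ?U - (\<Sum>i<N. ?m (A i))"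
    for N
  proof -
    let ?S = "\<lambda>x. \<Sum>i<N. P (A i) u x"
    have S: "?S \<in> L2" using PL by (intro L2_sum) auto
    have SU: "L2_inner ?S (P ?U u) = (\<Sum>i<N. complex_of_real (?m (A i)))"
      using PL Ai U u
      by (subst L2_inner_sum_left) (auto simp: inner_P_P norm_P_power2 Int_absorb2 UN_upper
            simp del: of_real_power intro!: sum.cong arg_cong[where f = "\<lambda>B. L2_inner (P B u) u"])
    have US: "L2_inner (P ?U u) ?S = (\<Sum>i<N. complex_of_real (?m (A i)))"
      by (subst L2_inner_commute) (simp add: SU)
    have "L2_inner (P (A i) u) (P (A j) u) = (if i = j then complex_of_real (?m (A i)) else 0)" for i j
    proof (cases "i = j")
      case False
      then have "A i \<inter> A j = {}" using A(2) by (auto simp: disjoint_family_on_def)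
      then show ?thesis
        using False inner_P_P[OF Ai[of i] Ai[of j] u u] norm_P_power2[of "{}" u] norm_P_empty[OF u] u by simp
    qed (simp add: L2_inner_self)
    then have SS: "L2_inner ?S ?S = (\<Sum>i<N. complex_of_real (?m (A i)))"
      using PL S by (subst L2_inner_sum_left; (subst L2_inner_sum_right)?) (auto simp: sum.delta)
    have "complex_of_real ((L2_norm_on UNIV (\<lambda>x. ?S x - P ?U u x))\<^sup>2)
        = complex_of_real (?m ?U - (\<Sum>i<N. ?m (A i)))"
      using S PL L2_diff[OF S PL(2)] SU US SS
      by (simp add: L2_inner_diff_left L2_inner_diff_right L2_inner_self[symmetric] of_real_diff
          of_real_sum del: of_real_power)
    then show ?thesis by (simp only: of_real_eq_iff)
  qed
  have "(\<lambda>N. (L2_norm_on UNIV (\<lambda>x. (\<Sum>i<N. P (A i) u x) - P ?U u x))\<^sup>2) \<longlonglongrightarrow> 0\<^sup>2"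
    by (intro tendsto_power P_countably_additive A u)
  then have "(\<lambda>N. ?m ?U - (\<Sum>i<N. ?m (A i))) \<longlonglongrightarrow> 0"
    by (simp only: eq) simp
  then have "(\<lambda>N. ?m ?U - (?m ?U - (\<Sum>i<N. ?m (A i)))) \<longlonglongrightarrow> ?m ?U - 0"
    by (intro tendsto_intros)
  then show ?thesis by (simp add: sums_def)
qed

section \<open>The spectral measure of a vector\<close>

lemma sets_spectral_measure [simp, measurable_cong]: "sets (spectral_measure P u) = sets borel"
  by (simp add: spectral_measure_def sets.sigma_sets_eq[of borel, simplified])

lemma space_spectral_measure [simp]: "space (spectral_measure P u) = UNIV"
  by (simp add: spectral_measure_def)

text \<open>\<open>measure_of\<close> takes the prescribed values only if they form a measure, and
  is zero otherwise; \<open>norm_P_empty\<close> and \<open>norm_P_sums\<close> supply the two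
  conditions.\<close>

lemma emeasure_spectral_measure:
  assumes u: "u \<in> L2" and B: "B \<in> sets borel"
  shows "emeasure (spectral_measure P u) B = ennreal ((L2_norm_on UNIV (P B u))\<^sup>2)"
proof (rule emeasure_measure_of[OF spectral_measure_def])
  show "positive (sets (spectral_measure P u)) (\<lambda>B. ennreal ((L2_norm_on UNIV (P B u))\<^sup>2))"
    using norm_P_empty[OF u] by (simp add: positive_def)
  show "countably_additive (sets (spectral_measure P u)) (\<lambda>B. ennreal ((L2_norm_on UNIV (P B u))\<^sup>2))"
  proof (rule countably_additiveI)
    fix A :: "nat \<Rightarrow> real set"
    assume "range A \<subseteq> sets (spectral_measure P u)" "disjoint_family A"
    then have "(\<lambda>i. (L2_norm_on UNIV (P (A i) u))\<^sup>2) sums (L2_norm_on UNIV (P (\<Union>i. A i) u))\<^sup>2"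
      by (intro norm_P_sums u) auto
    then show "(\<Sum>i. ennreal ((L2_norm_on UNIV (P (A i) u))\<^sup>2))
        = ennreal ((L2_norm_on UNIV (P (\<Union>i. A i) u))\<^sup>2)"
      by (simp add: suminf_ennreal2 sums_iff)
  qed
qed (use B in auto)

lemma finite_measure_spectral_measure: "u \<in> L2 \<Longrightarrow> finite_measure (spectral_measure P u)"
  by (rule finite_measureI) (simp add: emeasure_spectral_measure)

lemma measure_spectral_measure:
  assumes "u \<in> L2" "B \<in> sets borel"
  shows "complex_of_real (measure (spectral_measure P u) B) = L2_inner (P B u) u"
  using assms by (simp add: measure_def emeasure_spectral_measure flip: norm_P_power2)

text \<open>A bounded function is square integrable against every finite measure, so no domain
  questions arise for it.\<close>

lemma spectral_domain_eq_L2: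
  assumes "bounded_borel f"
  shows "spectral_domain P f = L2"
proof -
  have "integrable (spectral_measure P u) (\<lambda>s. (cmod (f s))\<^sup>2)" if "u \<in> L2" for u
  proof -
    interpret finite_measure "spectral_measure P u"
      using that by (rule finite_measure_spectral_measure)
    obtain K where K: "\<And>x. cmod (f x) \<le> K" using assms by (auto simp: bounded_borel_def)
    have [measurable]: "f \<in> borel_measurable borel" using assms by (simp add: bounded_borel_def)
    show ?thesis
      by (rule integrable_const_bound[where B = "K\<^sup>2"]) (auto intro!: power_mono K)
  qed
  then show ?thesis by (auto simp: spectral_domain_def)
qed

section \<open>The sesquilinear form of a bounded function\<close>

lemma spectral_integral_iff:
  assumes "bounded_borel f"
  shows "(u, w) \<in> spectral_integral P f \<longleftrightarrow>
    u \<in> L2 \<and> w \<in> L2 \<and> (\<forall>v\<in>L2. L2_inner w v = spectral_form P f u v)"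
  using assms by (auto simp: spectral_integral_def spectral_domain_eq_L2 spectral_form_def)

lemma bounded_convergence_functional_spectral_form:
  assumes "u \<in> L2" "v \<in> L2"
  shows "bounded_convergence_functional (\<lambda>f. spectral_form P f u v)"
proof -
  have "bounded_convergence_functional (\<lambda>f. \<Sum>k<4. (\<i> ^ k / 4) *
      (LINT s|spectral_measure P (\<lambda>x. u x + \<i> ^ k * v x). f s))"
    using assms by (intro bounded_convergence_functional_sum bounded_convergence_functional_integral
        finite_measure_spectral_measure L2_add L2_cmult sets_spectral_measure)
  then show ?thesis
    by (simp add: spectral_form_def sum_divide_distrib)
qed

text \<open>Polarization: with \<open>c = \<i> ^ k\<close>, multiplying \<open>q\<close> by
  \<open>\<i> ^ k\<close> and summing over \<open>k < 4\<close> kills all terms except the one with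
  the single factor \<open>cnj c\<close>, whose coefficients add up to 4.\<close>

lemma spectral_form_indicator:
  assumes u: "u \<in> L2" and v: "v \<in> L2" and B: "B \<in> sets borel"
  shows "spectral_form P (indicator B) u v = L2_inner (P B u) v"
proof -
  have q: "(LINT s|spectral_measure P (\<lambda>x. u x + c * v x). indicator B s) =
      L2_inner (P B u) u + cnj c * L2_inner (P B u) v + c * L2_inner (P B v) u
      + c * cnj c * L2_inner (P B v) v" for c
  proof -
    let ?z = "\<lambda>x. u x + c * v x"
    have cv: "(\<lambda>x. c * v x) \<in> L2" by (rule L2_cmult[OF v])
    have z: "?z \<in> L2" by (rule L2_add[OF u cv])
    interpret finite_measure "spectral_measure P ?z"
      using z by (rule finite_measure_spectral_measure)
    have "(LINT s|spectral_measure P ?z. indicator B s) = complex_of_real (measure (spectral_measure P ?z) B)"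
    proof -
      have "(indicator B :: real \<Rightarrow> complex) = (\<lambda>s. complex_of_real (indicator B s))"
        by (auto simp: indicator_def)
      then show ?thesis by simp
    qed
    also have "\<dots> = L2_inner (P B ?z) ?z" by (rule measure_spectral_measure[OF z B])
    \<comment> \<open>The second argument is expanded first, then symmetry takes \<open>P B\<close>
      off \<open>?z\<close> and puts it on \<open>u\<close> and \<open>v\<close>; so the linearity
      used is that of the inner product, never that of \<open>P B\<close>.\<close>
    also have "\<dots> = L2_inner ?z (P B u) + cnj c * L2_inner ?z (P B v)"
      using P_L2[OF B z] P_L2[OF B u] P_L2[OF B v] z u v cv B
      by (simp add: L2_inner_add_right L2_inner_cmult_right P_symmetric)
    also have "\<dots> = L2_inner u (P B u) + c * L2_inner v (P B u) + cnj c * (L2_inner u (P B v) + c * L2_inner v (P B v))"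
      using P_L2[OF B u] P_L2[OF B v] z u v cv
      by (simp add: L2_inner_add_left L2_inner_cmult_left)
    also have "\<dots> = L2_inner (P B u) u + cnj c * L2_inner (P B u) v + c * L2_inner (P B v) u
      + c * cnj c * L2_inner (P B v) v"
      using u v B by (simp add: P_symmetric algebra_simps)
    finally show ?thesis .
  qed
  show ?thesis
    unfolding spectral_form_def q by (simp add: eval_nat_numeral algebra_simps)
qed

text \<open>Multiplicativity with one factor an indicator: for \<open>f\<close> the indicator of
  \<open>B'\<close>, both sides are \<open>L2_inner (P (B' \<inter> B) u) v\<close>.\<close>

lemma spectral_form_P_right:
  assumes u: "u \<in> L2" and v: "v \<in> L2" and B: "B \<in> sets borel" and f: "bounded_borel f"
  shows "spectral_form P f u (P B v) = spectral_form P (\<lambda>s. indicator B s * f s) u v"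
  using f
proof (rule bounded_convergence_functional_eqI[rotated -1])
  show "bounded_convergence_functional (\<lambda>f. spectral_form P f u (P B v))"
    using assms by (intro bounded_convergence_functional_spectral_form P_L2)
  show "bounded_convergence_functional (\<lambda>f. spectral_form P (\<lambda>s. indicator B s * f s) u v)"
    using assms by (intro bounded_convergence_functional_mult[of "\<lambda>f. spectral_form P f u v"]
        bounded_convergence_functional_spectral_form bounded_borel_indicator)
  fix B' :: "real set" assume B': "B' \<in> sets borel"
  have "spectral_form P (\<lambda>s. indicator B s * indicator B' s) u v = spectral_form P (indicator (B' \<inter> B)) u v"
    by (rule arg_cong[where f = "\<lambda>f. spectral_form P f u v"]) (auto simp: indicator_def)
  then show "spectral_form P (indicator B') u (P B v) = spectral_form P (\<lambda>s. indicator B s * indicator B' s) u v"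
    using assms B' by (simp add: spectral_form_indicator P_L2 inner_P_P)
qed

text \<open>Multiplicativity of the functional calculus in weak form: applying \<open>g\<close> and
  then \<open>f\<close> amounts to integrating their product. For \<open>f\<close> an indicator it
  reduces to \<open>spectral_form_P_right\<close>.\<close>

lemma spectral_form_spectral_integral_left:
  assumes uw: "(u, w) \<in> spectral_integral P g" and g: "bounded_borel g"
    and v: "v \<in> L2" and f: "bounded_borel f"
  shows "spectral_form P f w v = spectral_form P (\<lambda>s. g s * f s) u v"
  using f
proof (rule bounded_convergence_functional_eqI[rotated -1])
  have u: "u \<in> L2" and w: "w \<in> L2" and eq: "\<And>v. v \<in> L2 \<Longrightarrow> L2_inner w v = spectral_form P g u v"
    using uw by (auto simp: spectral_integral_iff[OF g])
  show "bounded_convergence_functional (\<lambda>f. spectral_form P f w v)"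
    using w v by (rule bounded_convergence_functional_spectral_form)
  show "bounded_convergence_functional (\<lambda>f. spectral_form P (\<lambda>s. g s * f s) u v)"
    using u v g by (intro bounded_convergence_functional_mult[of "\<lambda>f. spectral_form P f u v"]
        bounded_convergence_functional_spectral_form)
  fix B :: "real set" assume B: "B \<in> sets borel"
  \<comment> \<open>Symmetry moves \<open>P B\<close> onto the test vector, where the relation
    defining \<open>w\<close> applies with \<open>P B v\<close> in place of
    \<open>v\<close>.\<close>
  have "spectral_form P (indicator B) w v = spectral_form P g u (P B v)"
    using B w v by (simp add: spectral_form_indicator P_symmetric eq P_L2)
  also have "\<dots> = spectral_form P (\<lambda>s. indicator B s * g s) u v"
    using u v B g by (rule spectral_form_P_right)
  finally show "spectral_form P (indicator B) w v = spectral_form P (\<lambda>s. g s * indicator B s) u v"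
    by (simp only: mult.commute[of "indicator B _"])
qed

text \<open>The adjoint belongs to the conjugate function; on indicators, which are real, this is
  the symmetry of \<open>P B\<close>.\<close>

lemma spectral_form_commute:
  assumes u: "u \<in> L2" and v: "v \<in> L2" and f: "bounded_borel f"
  shows "spectral_form P f v u = cnj (spectral_form P (\<lambda>s. cnj (f s)) u v)"
  using f
proof (rule bounded_convergence_functional_eqI[rotated -1])
  show "bounded_convergence_functional (\<lambda>f. spectral_form P f v u)"
    using v u by (rule bounded_convergence_functional_spectral_form)
  show "bounded_convergence_functional (\<lambda>f. cnj (spectral_form P (\<lambda>s. cnj (f s)) u v))"
    using u v by (intro bounded_convergence_functional_cnj[of "\<lambda>f. spectral_form P f u v"]
        bounded_convergence_functional_spectral_form)
  fix B :: "real set" assume B: "B \<in> sets borel"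
  have "(\<lambda>s. cnj (indicator B s)) = (indicator B :: real \<Rightarrow> complex)"
    by (auto simp: indicator_def)
  then show "spectral_form P (indicator B) v u = cnj (spectral_form P (\<lambda>s. cnj (indicator B s)) u v)"
    using u v B L2_inner_commute[of "P B v" u] by (simp add: spectral_form_indicator P_symmetric)
qed

lemma spectral_form_one:
  assumes "u \<in> L2" "v \<in> L2"
  shows "spectral_form P (\<lambda>_. 1) u v = L2_inner u v"
proof -
  have "spectral_form P (\<lambda>_. 1) u v = spectral_form P (indicator UNIV) u v"
    by (rule arg_cong[where f = "\<lambda>f. spectral_form P f u v"]) (auto simp: indicator_def)
  also have "\<dots> = L2_inner (P UNIV u) v"
    using assms by (intro spectral_form_indicator) auto
  also have "\<dots> = L2_inner u v"
    using assms by (intro L2_inner_cong_AE P_UNIV P_L2) auto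
  finally show ?thesis .
qed

text \<open>The factor \<open>g\<close> crosses the inner product as its conjugate by
  \<open>spectral_form_commute\<close> and then merges with \<open>f\<close> by
  multiplicativity.\<close>

lemma inner_spectral_integral:
  assumes uw: "(u, w) \<in> spectral_integral P f" and f: "bounded_borel f"
    and uz: "(u, z) \<in> spectral_integral P g" and g: "bounded_borel g"
  shows "L2_inner w z = spectral_form P (\<lambda>s. f s * cnj (g s)) u u"
proof -
  have u: "u \<in> L2" and w: "w \<in> L2" and z: "z \<in> L2"
    and eq: "\<And>v. v \<in> L2 \<Longrightarrow> L2_inner z v = spectral_form P g u v"
    using uw uz by (auto simp: spectral_integral_iff f g)
  have "L2_inner w z = cnj (spectral_form P g u w)"
    using L2_inner_commute[of w z] eq[OF w] by simp
  also have "\<dots> = spectral_form P (\<lambda>s. cnj (g s)) w u"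
    using spectral_form_commute[OF u w bounded_borel_cnj[OF g]] by simp
  also have "\<dots> = spectral_form P (\<lambda>s. f s * cnj (g s)) u u"
    using uw f u bounded_borel_cnj[OF g] by (rule spectral_form_spectral_integral_left)
  finally show ?thesis .
qed

end

section \<open>The unitary group\<close>

text \<open>A single \<open>P\<close> serves all times \<open>t\<close>, as
  \<open>unitary_orbit\<close> provides; this lets states at different times be compared.\<close>

locale spectral_orbit = pvm P
  for P :: "real set \<Rightarrow> ('a::euclidean_space \<Rightarrow> complex) \<Rightarrow> ('a \<Rightarrow> complex)" +
  fixes w :: "'a \<Rightarrow> complex" and u :: "real \<Rightarrow> 'a \<Rightarrow> complex"
  assumes orbit: "(w, u t) \<in> spectral_integral P (\<lambda>s. cis (- (t * s)))"
begin

section \<open>Group law, conserved norm and strong continuity of the orbit\<close>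

lemma initial_L2: "w \<in> L2" and orbit_L2: "u t \<in> L2"
  using orbit[of 0] orbit[of t] by (auto simp: spectral_integral_iff[OF bounded_borel_cis])

text \<open>The exponential of a sum splits into a product, to which multiplicativity applies. The
  orbit can thus be restarted at \<open>u s\<close> with the same \<open>P\<close>.\<close>

lemma orbit_shift: "(u s, u (s + t)) \<in> spectral_integral P (\<lambda>x. cis (- (t * x)))"
proof -
  have "L2_inner (u (s + t)) v = spectral_form P (\<lambda>x. cis (- (t * x))) (u s) v" if v: "v \<in> L2" for v
  proof -
    have "L2_inner (u (s + t)) v = spectral_form P (\<lambda>x. cis (- ((s + t) * x))) w v"
      using orbit[of "s + t"] v unfolding spectral_integral_iff[OF bounded_borel_cis] by blast
    also have "\<dots> = spectral_form P (\<lambda>x. cis (- (s * x)) * cis (- (t * x))) w v"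
      by (simp add: cis_mult algebra_simps)
    also have "\<dots> = spectral_form P (\<lambda>x. cis (- (t * x))) (u s) v"
      by (rule spectral_form_spectral_integral_left[OF orbit bounded_borel_cis v bounded_borel_cis, symmetric])
    finally show ?thesis .
  qed
  then show ?thesis
    by (simp add: spectral_integral_iff[OF bounded_borel_cis] orbit_L2)
qed

text \<open>Only the time difference enters, so unitarity and strong continuity can both be read off
  this formula.\<close>

lemma inner_orbit: "L2_inner (u s) (u t) = spectral_form P (\<lambda>x. cis (- ((s - t) * x))) w w"
  using inner_spectral_integral[OF orbit[of s] bounded_borel_cis orbit[of t] bounded_borel_cis]
  by (simp add: cis_cnj cis_mult algebra_simps)

lemma norm_orbit: "L2_norm_on UNIV (u t) = L2_norm_on UNIV w"
proof -
  have "complex_of_real ((L2_norm_on UNIV (u t))\<^sup>2) = complex_of_real ((L2_norm_on UNIV w)\<^sup>2)"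
    using inner_orbit[of t t] spectral_form_one[OF initial_L2 initial_L2]
    by (simp add: L2_inner_self del: of_real_power)
  then have "(L2_norm_on UNIV (u t))\<^sup>2 = (L2_norm_on UNIV w)\<^sup>2"
    by (simp only: of_real_eq_iff)
  then show ?thesis by simp
qed

text \<open>The squared distance is \<open>2 * ?F 0 - ?F (s - t) - ?F (t - s)\<close>, where
  \<open>?F\<close> is up to normalization the Fourier transform of the spectral measure of
  \<open>w\<close>. Bounded convergence, a statement about sequences, makes \<open>?F\<close>
  continuous at 0.\<close>

lemma tendsto_norm_orbit_diff: "((\<lambda>s. L2_norm_on UNIV (\<lambda>x. u s x - u t x)) \<longlongrightarrow> 0) (at t)"
proof (rule tendsto_at_iff_sequentially[THEN iffD2], intro allI impI)
  fix X :: "nat \<Rightarrow> real"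
  assume X: "X \<longlonglongrightarrow> t"
  let ?W = "(L2_norm_on UNIV w)\<^sup>2"
  let ?F = "\<lambda>r. spectral_form P (\<lambda>x. cis (- (r * x))) w w"
  have F0: "?F 0 = complex_of_real ?W"
    using spectral_form_one[OF initial_L2 initial_L2] by (simp add: L2_inner_self del: of_real_power)
  have lim: "(\<lambda>n. ?F (Y n)) \<longlonglongrightarrow> ?F 0" if "Y \<longlonglongrightarrow> 0" for Y :: "nat \<Rightarrow> real"
  proof (rule bounded_convergence_functionalD(3)[OF bounded_convergence_functional_spectral_form, where K = 1])
    show "(\<lambda>n. cis (- (Y n * x))) \<longlonglongrightarrow> cis (- (0 * x))" for x
      by (intro tendsto_intros that)
    show "(\<lambda>x. cis (- (r * x))) \<in> borel_measurable borel" for r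
      using bounded_borel_cis[of r] by (simp add: bounded_borel_def)
    from this show "(\<lambda>x. cis (- (r * x))) \<in> borel_measurable borel" for r .
  qed (auto simp: initial_L2)
  have eq: "complex_of_real ((L2_norm_on UNIV (\<lambda>x. u s x - u t x))\<^sup>2) = 2 * ?F 0 - ?F (s - t) - ?F (t - s)" for s
    using inner_orbit[of s t] inner_orbit[of t s] inner_orbit[of s s] inner_orbit[of t t]
    by (simp add: L2_inner_diff_left L2_inner_diff_right L2_diff orbit_L2 del: of_real_power flip: L2_inner_self)
  have "(\<lambda>n. complex_of_real ((L2_norm_on UNIV (\<lambda>x. u (X n) x - u t x))\<^sup>2)) \<longlonglongrightarrow> 2 * ?F 0 - ?F 0 - ?F 0"
    unfolding eq using X
    by (intro tendsto_intros lim) (auto intro!: tendsto_eq_intros)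
  then have "(\<lambda>n. complex_of_real ((L2_norm_on UNIV (\<lambda>x. u (X n) x - u t x))\<^sup>2)) \<longlonglongrightarrow> complex_of_real 0"
    by simp
  then have "(\<lambda>n. (L2_norm_on UNIV (\<lambda>x. u (X n) x - u t x))\<^sup>2) \<longlonglongrightarrow> 0"
    by (simp only: tendsto_of_real_iff)
  then show "((\<lambda>s. L2_norm_on UNIV (\<lambda>x. u s x - u t x)) \<circ> X) \<longlonglongrightarrow> 0"
    using tendsto_real_sqrt[of _ 0] by (fastforce simp: o_def)
qed

text \<open>Guarantees that the observation is integrable over bounded time intervals. The weight
  \<open>e\<close> is fixed first, from the conserved norm; then \<open>s\<close> approaches
  \<open>t\<close>.\<close>

lemma continuous_on_norm_on_orbit:
  assumes S: "S \<in> sets lebesgue"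
  shows "continuous_on A (\<lambda>t. (L2_norm_on S (u t))\<^sup>2)"
proof (intro continuous_at_imp_continuous_on ballI)
  fix t
  let ?W = "(L2_norm_on UNIV w)\<^sup>2" and ?d = "\<lambda>s. (L2_norm_on UNIV (\<lambda>x. u s x - u t x))\<^sup>2"
  show "isCont (\<lambda>t. (L2_norm_on S (u t))\<^sup>2) t"
    unfolding isCont_def
  proof (rule tendstoI)
    fix \<epsilon> :: real assume "\<epsilon> > 0"
    \<comment> \<open>The added 1 keeps the denominator positive when \<open>w\<close> has norm 0,
      and \<open>e * ?W\<close> is still at most half of \<open>\<epsilon>\<close>.\<close>
    define e where "e = \<epsilon> / (2 * (?W + 1))"
    have W1: "?W + 1 > 0" by (simp add: add_nonneg_pos)
    then have e: "e > 0" using \<open>\<epsilon> > 0\<close> by (simp add: e_def)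
    have "e * ?W \<le> e * (?W + 1)" using e by (intro mult_left_mono) auto
    also have "\<dots> = \<epsilon> / 2" using W1 by (simp add: e_def field_simps)
    finally have eW: "e * ?W \<le> \<epsilon> / 2" .
    have "((\<lambda>s. (1 + 1 / e) * ?d s) \<longlongrightarrow> (1 + 1 / e) * 0\<^sup>2) (at t)"
      by (intro tendsto_intros tendsto_norm_orbit_diff)
    then have "\<forall>\<^sub>F s in at t. (1 + 1 / e) * ?d s < \<epsilon> / 2"
      using \<open>\<epsilon> > 0\<close> by (intro order_tendstoD) auto
    then show "\<forall>\<^sub>F s in at t. dist ((L2_norm_on S (u s))\<^sup>2) ((L2_norm_on S (u t))\<^sup>2) < \<epsilon>"
    proof eventually_elim
      case (elim s)
      then show ?case
        using L2_norm_on_power2_diff_le[OF orbit_L2[of s] orbit_L2[of t] S e] eW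
        unfolding dist_real_def norm_orbit by linarith
    qed
  qed
qed

text \<open>As \<open>s\<close> runs through \<open>{0..T/2}\<close>, the times \<open>s\<close> and
  \<open>s + T / 2\<close> sweep the two halves of \<open>{0..T}\<close>, so integrating the squared
  two-time bound produces the observation integral.\<close>

lemma observability_of_two_point:
  assumes S: "S \<in> sets lebesgue" and T: "T > 0"
    and two_point: "\<And>s. L2_norm_on UNIV (u s) \<le> K * (L2_norm_on S (u s) + L2_norm_on S (u (s + T / 2)))"
  shows "(L2_norm_on UNIV w)\<^sup>2 \<le> 4 * K\<^sup>2 / T * (LINT t:{0..T}|lborel. (L2_norm_on S (u t))\<^sup>2)"
proof -
  let ?W = "(L2_norm_on UNIV w)\<^sup>2" and ?N = "\<lambda>t. (L2_norm_on S (u t))\<^sup>2"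
  have cont: "continuous_on A ?N" for A
    using S by (rule continuous_on_norm_on_orbit)
  have cont': "continuous_on A (\<lambda>t. ?N (t + T / 2))" for A
    by (rule continuous_on_compose2[OF cont[of UNIV]]) (auto intro!: continuous_intros)
  have pt: "?W \<le> 2 * K\<^sup>2 * (?N s + ?N (s + T / 2))" for s
  proof -
    let ?a = "L2_norm_on S (u s)" and ?b = "L2_norm_on S (u (s + T / 2))"
    have "L2_norm_on UNIV w \<le> K * (?a + ?b)"
      using two_point[of s] by (simp add: norm_orbit)
    \<comment> \<open>Squaring is monotone because the left side is nonnegative, whatever the sign
      of \<open>K\<close>.\<close>
    then have "?W \<le> (K * (?a + ?b))\<^sup>2"
      by (intro power_mono) auto
    also have "\<dots> \<le> K\<^sup>2 * (2 * (?a\<^sup>2 + ?b\<^sup>2))"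
      unfolding power_mult_distrib
      using sum_squares_bound[of ?a ?b] by (intro mult_left_mono) (auto simp: power2_sum)
    finally show ?thesis by (simp add: algebra_simps)
  qed
  \<comment> \<open>\<open>?W\<close> is constant in time, which explains the final constant:
    \<open>2 * K\<^sup>2\<close> divided by the length \<open>T / 2\<close>.\<close>
  have "?W * (T / 2) = integral {0..T/2} (\<lambda>s. ?W)"
    using T by simp
  also have "\<dots> \<le> integral {0..T/2} (\<lambda>s. 2 * K\<^sup>2 * (?N s + ?N (s + T / 2)))"
    by (intro integral_le integrable_continuous_real continuous_intros cont cont' pt)
  also have "\<dots> = 2 * K\<^sup>2 * (integral {0..T/2} ?N + integral {0..T/2} (\<lambda>s. ?N (s + T / 2)))"
    by (simp add: integral_add integrable_continuous_real cont cont')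
  also have "integral {0..T/2} (\<lambda>s. ?N (s + T / 2)) = integral {T/2..T} ?N"
    using integral_shift_real_ivl[of "T/2" "T/2" T ?N] by simp
  also have "integral {0..T/2} ?N + integral {T/2..T} ?N = integral {0..T} ?N"
    using T by (intro Henstock_Kurzweil_Integration.integral_combine integrable_continuous_real cont) auto
  \<comment> \<open>Continuity identifies the gauge integral, used for shifting and gluing, with the
    Lebesgue integral of the claim.\<close>
  also have "\<dots> = (LINT t:{0..T}|lborel. ?N t)"
    by (rule set_borel_integral_eq_integral(2)[symmetric]) (intro borel_integrable_atLeastAtMost' cont)
  finally show ?thesis
    using T by (simp add: field_simps)
qed

end

theorem theorem2p6:
  fixes H :: "'a::euclidean_space operator" and E :: "'a set"
  assumes "admissible_hamiltonian H"
    and "E \<in> sets lebesgue"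
    and "\<And>\<tau>::real. \<tau> \<noteq> 0 \<Longrightarrow>
      \<exists>C::real. \<forall>w u. w \<in> L2 \<longrightarrow> unitary_orbit H w u \<longrightarrow>
        (\<forall>t. L2_norm_on UNIV (u t) \<le> C * (L2_norm_on (- E) w + L2_norm_on (- E) (u \<tau>)))"
  shows "\<forall>T>0. \<exists>C::real. \<forall>u0 u. u0 \<in> L2 \<longrightarrow> unitary_orbit H u0 u \<longrightarrow>
           (L2_norm_on UNIV u0)\<^sup>2 \<le> C * (LINT t:{0..T}|lborel. (L2_norm_on (- E) (u t))\<^sup>2)"
proof (intro allI impI)
  fix T :: real assume T: "T > 0"
  have E: "- E \<in> sets lebesgue"
    using sets.compl_sets[OF assms(2)] by (simp add: Compl_eq_Diff_UNIV)
  \<comment> \<open>\<open>K\<close> depends on \<open>H\<close>, \<open>E\<close> and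
    \<open>T\<close> only, being fixed before any initial state; \<open>T / 2\<close> is an
    admissible \<open>\<tau>\<close> because it is nonzero.\<close>
  obtain K where K: "\<And>w u t. w \<in> L2 \<Longrightarrow> unitary_orbit H w u \<Longrightarrow>
      L2_norm_on UNIV (u t) \<le> K * (L2_norm_on (- E) w + L2_norm_on (- E) (u (T / 2)))"
    using assms(3)[of "T / 2"] T by auto
  have "(L2_norm_on UNIV u0)\<^sup>2 \<le> 4 * K\<^sup>2 / T * (LINT t:{0..T}|lborel. (L2_norm_on (- E) (u t))\<^sup>2)"
    if u: "unitary_orbit H u0 u" for u0 u
  proof -
    obtain P where P: "spectral_resolution H P"
      and orbit: "\<And>t. (u0, u t) \<in> spectral_integral P (\<lambda>s. cis (- (t * s)))"
      using u unfolding unitary_orbit_def by blast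
    interpret spectral_orbit P u0 u
      using P orbit by unfold_locales (simp_all add: spectral_resolution_def)
    have "unitary_orbit H (u s) (\<lambda>t. u (s + t))" for s
      using P orbit_shift[of s] by (auto simp: unitary_orbit_def)
    \<comment> \<open>The estimate for the orbit restarted at \<open>u s\<close> is read at time 0,
      where its left side is the norm of \<open>u s\<close> itself.\<close>
    then have "L2_norm_on UNIV (u s) \<le> K * (L2_norm_on (- E) (u s) + L2_norm_on (- E) (u (s + T / 2)))" for s
      using K[OF orbit_L2, of s "\<lambda>t. u (s + t)" 0] by simp
    then show ?thesis
      by (rule observability_of_two_point[OF E T])
  qed
  then show "\<exists>C. \<forall>u0 u. u0 \<in> L2 \<longrightarrow> unitary_orbit H u0 u \<longrightarrow>
      (L2_norm_on UNIV u0)\<^sup>2 \<le> C * (LINT t:{0..T}|lborel. (L2_norm_on (- E) (u t))\<^sup>2)"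
    by blast
qed

end
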